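(* Let $R$ be an associative ring with identity. If $R$ is $J$-quasipolar, then $R$ is $\delta$-quasipolar. The converse holds if $S_r \subseteq J(R)$; that is, if $S_r\subseteq J(R)$ and $R$ is $\delta$-quasipolar, then $R$ is $J$-quasipolar.
   Context: For $a\in R$, $comm(a)=\{x\in R \mid xa=ax\}$ and $comm^2(a)=\{x\in R\mid xy=yx \text{ for all } y\in comm(a)\}$. $J(R)$ is the Jacobson radical of $R$. $S_r$ is the right socle of $R$, i.e. the sum of the minimal right ideals of $R$. A right ideal $I$ of $R$ is $\delta$-small if whenever $R=I+K$ with $K$ a right ideal such that $R/K$ is a singular right $R$-module, then $R=K$. $\delta(R)$ is the sum of all $\delta$-small right ideals of $R$; it is a two-sided ideal and equals the intersection of all essential maximal right ideals of $R$ (equal to $R$ if there are none). An element $a\in R$ is $J$-quasipolar if there exists $p^2=p\in comm^2(a)$ with $a+p\in J(R)$; it is $\delta$-quasipolar if there exists $p^2=p\in comm^2(a)$ with $a+p\in\delta(R)$. The ring $R$ is $J$-quasipolar (resp. $\delta$-quasipolar) if every element of $R$ is. *)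

theory Defs
  imports "HOL-Algebra.AbelCoset" "HOL-Algebra.Module" "HOL-Algebra.Generated_Groups"
begin

section \<open>Right ideals\<close>

locale right_ideal = additive_subgroup I R + ring R for I and R (structure) +
  assumes I_r_closed: "\<lbrakk>a \<in> I; x \<in> carrier R\<rbrakk> \<Longrightarrow> a \<otimes> x \<in> I"

definition minimal_right_ideal :: "'a set \<Rightarrow> ('a, 'b) ring_scheme \<Rightarrow> bool" where
  "minimal_right_ideal I R \<longleftrightarrow> right_ideal I R \<and> I \<noteq> {\<zero>\<^bsub>R\<^esub>} \<and>
     (\<forall>K. right_ideal K R \<and> K \<subseteq> I \<longrightarrow> K = {\<zero>\<^bsub>R\<^esub>} \<or> K = I)"

definition maximal_right_ideal :: "'a set \<Rightarrow> ('a, 'b) ring_scheme \<Rightarrow> bool" where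
  "maximal_right_ideal I R \<longleftrightarrow> right_ideal I R \<and> I \<noteq> carrier R \<and>
     (\<forall>K. right_ideal K R \<and> I \<subseteq> K \<longrightarrow> K = I \<or> K = carrier R)"

definition essential_right_ideal :: "'a set \<Rightarrow> ('a, 'b) ring_scheme \<Rightarrow> bool" where
  "essential_right_ideal E R \<longleftrightarrow> right_ideal E R \<and>
     (\<forall>K. right_ideal K R \<and> K \<noteq> {\<zero>\<^bsub>R\<^esub>} \<longrightarrow> E \<inter> K \<noteq> {\<zero>\<^bsub>R\<^esub>})"

text \<open>The sum of a family \<open>F\<close> of right ideals, i.e. all finite sums of elements of members of
  \<open>F\<close>. It is \<open>{\<zero>}\<close> for the empty family.\<close>

definition right_ideal_sum :: "('a, 'b) ring_scheme \<Rightarrow> 'a set set \<Rightarrow> 'a set" where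
  "right_ideal_sum R F = generate (add_monoid R) (\<Union>F)"

section \<open>Right modules\<close>

text \<open>The record \<open>module\<close> is used for right modules as well: \<open>r \<odot>\<^bsub>M\<^esub> m\<close> stands for the right
  action \<open>m \<cdot> r\<close>, whence the order of the factors in \<open>smult_assoc\<close>. The ring multiplication and unit
  contained in that record play no role.\<close>

locale right_module = R?: ring R + M?: abelian_group M
  for R :: "('a, 'b) ring_scheme" (structure) and M :: "('a, 'm, 'c) module_scheme" (structure) +
  assumes smult_closed:
      "\<lbrakk>a \<in> carrier R; x \<in> carrier M\<rbrakk> \<Longrightarrow> a \<odot>\<^bsub>M\<^esub> x \<in> carrier M"
    and smult_add_ring:
      "\<lbrakk>a \<in> carrier R; b \<in> carrier R; x \<in> carrier M\<rbrakk> \<Longrightarrow>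
       (a \<oplus>\<^bsub>R\<^esub> b) \<odot>\<^bsub>M\<^esub> x = a \<odot>\<^bsub>M\<^esub> x \<oplus>\<^bsub>M\<^esub> b \<odot>\<^bsub>M\<^esub> x"
    and smult_add_module:
      "\<lbrakk>a \<in> carrier R; x \<in> carrier M; y \<in> carrier M\<rbrakk> \<Longrightarrow>
       a \<odot>\<^bsub>M\<^esub> (x \<oplus>\<^bsub>M\<^esub> y) = a \<odot>\<^bsub>M\<^esub> x \<oplus>\<^bsub>M\<^esub> a \<odot>\<^bsub>M\<^esub> y"
    and smult_assoc:
      "\<lbrakk>a \<in> carrier R; b \<in> carrier R; x \<in> carrier M\<rbrakk> \<Longrightarrow>
       (a \<otimes>\<^bsub>R\<^esub> b) \<odot>\<^bsub>M\<^esub> x = b \<odot>\<^bsub>M\<^esub> (a \<odot>\<^bsub>M\<^esub> x)"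
    and smult_one: "x \<in> carrier M \<Longrightarrow> \<one>\<^bsub>R\<^esub> \<odot>\<^bsub>M\<^esub> x = x"

definition right_annihilator ::
    "('a, 'b) ring_scheme \<Rightarrow> ('a, 'm, 'c) module_scheme \<Rightarrow> 'm \<Rightarrow> 'a set" where
  "right_annihilator R M m = {r \<in> carrier R. r \<odot>\<^bsub>M\<^esub> m = \<zero>\<^bsub>M\<^esub>}"

definition singular_submodule ::
    "('a, 'b) ring_scheme \<Rightarrow> ('a, 'm, 'c) module_scheme \<Rightarrow> 'm set" where
  "singular_submodule R M = {m \<in> carrier M. essential_right_ideal (right_annihilator R M m) R}"

definition singular_right_module ::
    "('a, 'b) ring_scheme \<Rightarrow> ('a, 'm, 'c) module_scheme \<Rightarrow> bool" where
  "singular_right_module R M \<longleftrightarrow> right_module R M \<and> singular_submodule R M = carrier M"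

text \<open>The right module \<open>R/K\<close>, with \<open>(K + x) \<cdot> r = K + x r\<close>.\<close>

definition quotient_right_module ::
    "('a, 'b) ring_scheme \<Rightarrow> 'a set \<Rightarrow> ('a, 'a set) module" where
  "quotient_right_module R K =
     \<lparr>carrier = a_rcosets\<^bsub>R\<^esub> K, mult = undefined, one = undefined, zero = K, add = set_add R,
      smult = (\<lambda>r C. \<Union>x\<in>C. K +>\<^bsub>R\<^esub> (x \<otimes>\<^bsub>R\<^esub> r))\<rparr>"

lemma (in right_ideal) quotient_abelian_subgroup: "abelian_subgroup I R"
  by (intro abelian_subgroupI3 additive_subgroup_axioms abelian_group_axioms)

lemma (in right_ideal) quotient_smult:
  assumes "x \<in> carrier R" "r \<in> carrier R"
  shows "r \<odot>\<^bsub>quotient_right_module R I\<^esub> (I +> x) = I +> (x \<otimes> r)"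
proof -
  interpret abelian_subgroup I R by (rule quotient_abelian_subgroup)
  have "I +> (y \<otimes> r) = I +> (x \<otimes> r)" if "y \<in> I +> x" for y
  proof -
    obtain h where h: "h \<in> I" "y = h \<oplus> x"
      using \<open>y \<in> I +> x\<close> by (auto simp: a_r_coset_def r_coset_def)
    have hc: "h \<in> carrier R" using h(1) by (rule a_Hcarr)
    have "y \<otimes> r = h \<otimes> r \<oplus> x \<otimes> r" using h hc assms by (simp add: l_distr)
    then have "y \<otimes> r \<in> I +> (x \<otimes> r)"
      using I_r_closed[OF h(1) assms(2)] by (auto simp: a_r_coset_def r_coset_def)
    then show ?thesis using assms a_repr_independence' m_closed by blast
  qed
  moreover have "x \<in> I +> x" using assms(1) by (rule a_rcos_self)
  ultimately have "(\<Union>y\<in>I +> x. I +> (y \<otimes> r)) = I +> (x \<otimes> r)" by blast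
  then show ?thesis by (simp add: quotient_right_module_def)
qed

lemma (in right_ideal) quotient_right_module: "right_module R (quotient_right_module R I)"
proof -
  interpret abelian_subgroup I R by (rule quotient_abelian_subgroup)
  let ?M = "quotient_right_module R I"
  have car: "carrier ?M = a_rcosets I" and add: "\<And>A B. A \<oplus>\<^bsub>?M\<^esub> B = A <+> B"
    and zero: "\<zero>\<^bsub>?M\<^esub> = I"
    by (simp_all add: quotient_right_module_def)
  have coset: "\<exists>x\<in>carrier R. C = I +> x" if "C \<in> carrier ?M" for C
    using that by (auto simp: car A_RCOSETS_def' )
  have mem: "I +> x \<in> carrier ?M" if "x \<in> carrier R" for x
    using that by (simp add: car a_rcosetsI a_subset)
  have sum: "(I +> x) \<oplus>\<^bsub>?M\<^esub> (I +> y) = I +> (x \<oplus> y)" if "x \<in> carrier R" "y \<in> carrier R" for x y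
    using that by (simp add: add a_rcos_sum)
  have z: "\<zero>\<^bsub>?M\<^esub> = I +> \<zero>" by (simp add: zero a_coset_add_zero a_subset)
  have "abelian_group ?M"
  proof (rule abelian_groupI)
    show "\<zero>\<^bsub>?M\<^esub> \<in> carrier ?M" by (simp add: z mem)
  next
    fix A assume "A \<in> carrier ?M"
    then obtain x where x: "x \<in> carrier R" "A = I +> x" using coset by blast
    then show "\<zero>\<^bsub>?M\<^esub> \<oplus>\<^bsub>?M\<^esub> A = A" using sum[of "\<zero>" x] by (simp add: z)
    show "\<exists>B\<in>carrier ?M. B \<oplus>\<^bsub>?M\<^esub> A = \<zero>\<^bsub>?M\<^esub>"
      using x by (intro bexI[of _ "I +> (\<ominus> x)"]) (simp_all add: sum mem z l_neg)
    fix B assume "B \<in> carrier ?M"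
    then obtain y where y: "y \<in> carrier R" "B = I +> y" using coset by blast
    show "A \<oplus>\<^bsub>?M\<^esub> B \<in> carrier ?M" using x y by (simp add: sum mem)
    show "A \<oplus>\<^bsub>?M\<^esub> B = B \<oplus>\<^bsub>?M\<^esub> A" using x y by (simp add: sum a_comm)
    fix C assume "C \<in> carrier ?M"
    then obtain w where w: "w \<in> carrier R" "C = I +> w" using coset by blast
    show "A \<oplus>\<^bsub>?M\<^esub> B \<oplus>\<^bsub>?M\<^esub> C = A \<oplus>\<^bsub>?M\<^esub> (B \<oplus>\<^bsub>?M\<^esub> C)"
      using x y w by (simp add: sum a_assoc)
  qed
  moreover have "right_module_axioms R ?M"
  proof
    fix a X assume a: "a \<in> carrier R" and "X \<in> carrier ?M"
    then obtain x where x: "x \<in> carrier R" "X = I +> x" using coset by blast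
    show "a \<odot>\<^bsub>?M\<^esub> X \<in> carrier ?M" using a x by (simp add: quotient_smult mem)
    fix Y assume "Y \<in> carrier ?M"
    then obtain y where y: "y \<in> carrier R" "Y = I +> y" using coset by blast
    show "a \<odot>\<^bsub>?M\<^esub> (X \<oplus>\<^bsub>?M\<^esub> Y) = a \<odot>\<^bsub>?M\<^esub> X \<oplus>\<^bsub>?M\<^esub> a \<odot>\<^bsub>?M\<^esub> Y"
      using a x y by (simp add: quotient_smult sum l_distr)
  next
    fix a b X assume ab: "a \<in> carrier R" "b \<in> carrier R" and "X \<in> carrier ?M"
    then obtain x where x: "x \<in> carrier R" "X = I +> x" using coset by blast
    show "(a \<oplus> b) \<odot>\<^bsub>?M\<^esub> X = a \<odot>\<^bsub>?M\<^esub> X \<oplus>\<^bsub>?M\<^esub> b \<odot>\<^bsub>?M\<^esub> X"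
      using ab x by (simp add: quotient_smult sum r_distr)
    show "(a \<otimes> b) \<odot>\<^bsub>?M\<^esub> X = b \<odot>\<^bsub>?M\<^esub> (a \<odot>\<^bsub>?M\<^esub> X)"
      using ab x by (simp add: quotient_smult m_assoc)
  next
    fix X assume "X \<in> carrier ?M"
    then obtain x where x: "x \<in> carrier R" "X = I +> x" using coset by blast
    then show "\<one> \<odot>\<^bsub>?M\<^esub> X = X" by (simp add: quotient_smult)
  qed
  ultimately show ?thesis by (intro right_module.intro ring_axioms)
qed

section \<open>Radicals and socle\<close>

text \<open>The whole ring if there is no maximal right ideal, i.e. for the zero ring.\<close>

definition jacobson_radical :: "('a, 'b) ring_scheme \<Rightarrow> 'a set" where
  "jacobson_radical R = {x \<in> carrier R. \<forall>I. maximal_right_ideal I R \<longrightarrow> x \<in> I}"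

definition right_socle :: "('a, 'b) ring_scheme \<Rightarrow> 'a set" where
  "right_socle R = right_ideal_sum R {I. minimal_right_ideal I R}"

definition delta_small :: "'a set \<Rightarrow> ('a, 'b) ring_scheme \<Rightarrow> bool" where
  "delta_small I R \<longleftrightarrow> right_ideal I R \<and>
     (\<forall>K. right_ideal K R \<and> singular_right_module R (quotient_right_module R K) \<and>
          carrier R = I <+>\<^bsub>R\<^esub> K \<longrightarrow> carrier R = K)"

definition delta_radical :: "('a, 'b) ring_scheme \<Rightarrow> 'a set" where
  "delta_radical R = right_ideal_sum R {I. delta_small I R}"

section \<open>Quasipolarity\<close>

definition ring_comm :: "('a, 'b) ring_scheme \<Rightarrow> 'a \<Rightarrow> 'a set" where
  "ring_comm R a = {x \<in> carrier R. x \<otimes>\<^bsub>R\<^esub> a = a \<otimes>\<^bsub>R\<^esub> x}"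

definition ring_comm2 :: "('a, 'b) ring_scheme \<Rightarrow> 'a \<Rightarrow> 'a set" where
  "ring_comm2 R a = {x \<in> carrier R. \<forall>y \<in> ring_comm R a. x \<otimes>\<^bsub>R\<^esub> y = y \<otimes>\<^bsub>R\<^esub> x}"

definition J_quasipolar_elem :: "('a, 'b) ring_scheme \<Rightarrow> 'a \<Rightarrow> bool" where
  "J_quasipolar_elem R a \<longleftrightarrow>
     (\<exists>p \<in> ring_comm2 R a. p \<otimes>\<^bsub>R\<^esub> p = p \<and> a \<oplus>\<^bsub>R\<^esub> p \<in> jacobson_radical R)"

definition delta_quasipolar_elem :: "('a, 'b) ring_scheme \<Rightarrow> 'a \<Rightarrow> bool" where
  "delta_quasipolar_elem R a \<longleftrightarrow>
     (\<exists>p \<in> ring_comm2 R a. p \<otimes>\<^bsub>R\<^esub> p = p \<and> a \<oplus>\<^bsub>R\<^esub> p \<in> delta_radical R)"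

definition J_quasipolar :: "('a, 'b) ring_scheme \<Rightarrow> bool" where
  "J_quasipolar R \<longleftrightarrow> (\<forall>a \<in> carrier R. J_quasipolar_elem R a)"

definition delta_quasipolar :: "('a, 'b) ring_scheme \<Rightarrow> bool" where
  "delta_quasipolar R \<longleftrightarrow> (\<forall>a \<in> carrier R. delta_quasipolar_elem R a)"

end

theory Submission
  imports Defs
begin

text \<open>Both directions compare radicals. By Zorn's lemma a proper right ideal lies in a maximal one, so
  \<open>J(R)\<close> is \<open>\<delta>\<close>-small and \<open>J(R) \<subseteq> \<delta>(R)\<close>. Conversely, suppose a \<open>\<delta>\<close>-small \<open>I\<close> is not contained in
  a maximal right ideal \<open>M\<close>, so that \<open>I + M = R\<close>. If \<open>M\<close> is essential, then \<open>R/M\<close> is singular,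
  contradicting the smallness of \<open>I\<close>. Otherwise \<open>M \<inter> K = 0\<close> for some \<open>K \<noteq> 0\<close>, and \<open>K\<close> is minimal
  because \<open>M\<close> is maximal; so \<open>K \<subseteq> S\<^sub>r \<subseteq> J(R) \<subseteq> M\<close>, which is absurd.\<close>

context ring
begin

lemma right_idealI:
  assumes "I \<subseteq> carrier R" "\<zero> \<in> I"
    and "\<And>x y. x \<in> I \<Longrightarrow> y \<in> I \<Longrightarrow> x \<oplus> y \<in> I"
    and r_closed: "\<And>x r. x \<in> I \<Longrightarrow> r \<in> carrier R \<Longrightarrow> x \<otimes> r \<in> I"
  shows "right_ideal I R"
proof -
  \<comment> \<open>Closure under negation comes from right multiplication:
    \<open>\<ominus> x = x \<otimes> \<ominus> \<one>\<close>.\<close>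
  have "\<ominus> x \<in> I" if "x \<in> I" for x
    using r_closed[OF that, of "\<ominus> \<one>"] that assms(1) by (auto simp: r_minus)
  then have "subgroup I (add_monoid R)"
    using assms by (intro add.subgroupI) (auto simp: a_inv_def)
  then show ?thesis
    by (intro right_ideal.intro additive_subgroup.intro ring_axioms right_ideal_axioms.intro r_closed)
qed

lemma
  assumes "right_ideal I R"
  shows right_ideal_subset: "I \<subseteq> carrier R"
    and right_ideal_zero: "\<zero> \<in> I"
    and right_ideal_add: "x \<in> I \<Longrightarrow> y \<in> I \<Longrightarrow> x \<oplus> y \<in> I"
    and right_ideal_neg: "x \<in> I \<Longrightarrow> \<ominus> x \<in> I"
    and right_ideal_mult: "x \<in> I \<Longrightarrow> r \<in> carrier R \<Longrightarrow> x \<otimes> r \<in> I"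
proof -
  interpret right_ideal I R by (rule assms)
  show "I \<subseteq> carrier R" "\<zero> \<in> I"
    "x \<in> I \<Longrightarrow> y \<in> I \<Longrightarrow> x \<oplus> y \<in> I" "x \<in> I \<Longrightarrow> \<ominus> x \<in> I"
    "x \<in> I \<Longrightarrow> r \<in> carrier R \<Longrightarrow> x \<otimes> r \<in> I"
    by (auto simp: I_r_closed)
qed

lemma right_ideal_eq_carrier:
  assumes "right_ideal I R" "\<one> \<in> I"
  shows "I = carrier R"
  using right_ideal_mult[OF assms] right_ideal_subset[OF assms(1)] by auto

lemma mem_set_add_iff: "z \<in> I <+>\<^bsub>R\<^esub> K \<longleftrightarrow> (\<exists>x\<in>I. \<exists>y\<in>K. z = x \<oplus> y)"
  by (auto simp: set_add_def')

lemma set_add_subset_right_ideal: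
  assumes "right_ideal M R" "I \<subseteq> M" "K \<subseteq> M"
  shows "I <+>\<^bsub>R\<^esub> K \<subseteq> M"
  using assms(2,3) by (auto simp: mem_set_add_iff intro!: right_ideal_add[OF assms(1)])

lemma right_ideal_set_add:
  assumes I: "right_ideal I R" and K: "right_ideal K R"
  shows "right_ideal (I <+>\<^bsub>R\<^esub> K) R"
proof (rule right_idealI)
  note car = right_ideal_subset[OF I, THEN subsetD] right_ideal_subset[OF K, THEN subsetD]
  show "I <+>\<^bsub>R\<^esub> K \<subseteq> carrier R" using car by (auto simp: mem_set_add_iff)
  show "\<zero> \<in> I <+>\<^bsub>R\<^esub> K"
    using right_ideal_zero[OF I] right_ideal_zero[OF K]
    by (auto simp: mem_set_add_iff intro!: bexI[of _ \<zero>])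
  fix z assume "z \<in> I <+>\<^bsub>R\<^esub> K"
  then obtain x y where xy: "x \<in> I" "y \<in> K" "z = x \<oplus> y" by (auto simp: mem_set_add_iff)
  show "z \<otimes> r \<in> I <+>\<^bsub>R\<^esub> K" if "r \<in> carrier R" for r
    using xy that car right_ideal_mult[OF I] right_ideal_mult[OF K]
    by (force simp: mem_set_add_iff l_distr)
  fix w assume "w \<in> I <+>\<^bsub>R\<^esub> K"
  then obtain u v where uv: "u \<in> I" "v \<in> K" "w = u \<oplus> v" by (auto simp: mem_set_add_iff)
  have "z \<oplus> w = (x \<oplus> u) \<oplus> (y \<oplus> v)" using xy uv car by (simp add: a_ac)
  then show "z \<oplus> w \<in> I <+>\<^bsub>R\<^esub> K"
    using xy uv right_ideal_add[OF I] right_ideal_add[OF K] unfolding mem_set_add_iff by metis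
qed

lemma subset_set_add:
  assumes "right_ideal I R" "right_ideal K R"
  shows "I \<subseteq> I <+>\<^bsub>R\<^esub> K" "K \<subseteq> I <+>\<^bsub>R\<^esub> K"
  using right_ideal_subset[OF assms(1)] right_ideal_zero[OF assms(1)]
    right_ideal_subset[OF assms(2)] right_ideal_zero[OF assms(2)]
  by (force simp: mem_set_add_iff)+

text \<open>The sum is a right ideal above \<open>M\<close>, and it differs from \<open>M\<close>
  because it contains \<open>I\<close>; maximality leaves only the whole ring.\<close>

lemma maximal_right_ideal_set_add:
  assumes M: "maximal_right_ideal M R" and I: "right_ideal I R" and nsub: "\<not> I \<subseteq> M"
  shows "I <+>\<^bsub>R\<^esub> M = carrier R"
proof -
  have M': "right_ideal M R" using M by (simp add: maximal_right_ideal_def)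
  show ?thesis
    using M nsub right_ideal_set_add[OF I M'] subset_set_add[OF I M']
    unfolding maximal_right_ideal_def by metis
qed

lemma ex_maximal_right_ideal:
  assumes K: "right_ideal K R" and proper: "K \<noteq> carrier R"
  obtains M where "maximal_right_ideal M R" "K \<subseteq> M"
proof -
  \<comment> \<open>Properness is expressed as \<open>\<one> \<notin> I\<close>, a condition that
    passes to unions of chains at once.\<close>
  define F where "F = {I. right_ideal I R \<and> \<one> \<notin> I \<and> K \<subseteq> I}"
  have "\<exists>M\<in>F. \<forall>X\<in>F. M \<subseteq> X \<longrightarrow> X = M"
  proof (rule subset_Zorn_nonempty)
    show "F \<noteq> {}" using K proper right_ideal_eq_carrier by (auto simp: F_def)
    fix C assume ne: "C \<noteq> {}" and "subset.chain F C"
    then have CF: "C \<subseteq> F" and chain: "\<And>X Y. X \<in> C \<Longrightarrow> Y \<in> C \<Longrightarrow> X \<subseteq> Y \<or> Y \<subseteq> X"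
      by (auto simp: subset.chain_def)
    have ri: "right_ideal X R" if "X \<in> C" for X using that CF by (auto simp: F_def)
    have "right_ideal (\<Union>C) R"
    proof (rule right_idealI)
      show "\<Union>C \<subseteq> carrier R" "\<zero> \<in> \<Union>C"
        using ne ri right_ideal_subset right_ideal_zero by blast+
      show "x \<oplus> y \<in> \<Union>C" if "x \<in> \<Union>C" "y \<in> \<Union>C" for x y
      proof -
        from that obtain X Y where "X \<in> C" "x \<in> X" "Y \<in> C" "y \<in> Y" by blast
        \<comment> \<open>The larger of \<open>X\<close> and \<open>Y\<close> contains both
          summands.\<close>
        then obtain Z where "Z \<in> C" "x \<in> Z" "y \<in> Z" using chain[of X Y] by blast
        then show ?thesis using right_ideal_add[OF ri] by blast
      qed
      show "x \<otimes> r \<in> \<Union>C" if "x \<in> \<Union>C" "r \<in> carrier R" for x r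
        using that ri right_ideal_mult by blast
    qed
    then show "\<Union>C \<in> F" using ne CF by (auto simp: F_def)
  qed
  then obtain M where M: "M \<in> F" and max: "\<And>X. X \<in> F \<Longrightarrow> M \<subseteq> X \<Longrightarrow> X = M" by blast
  have "maximal_right_ideal M R"
    unfolding maximal_right_ideal_def
    using M max right_ideal_eq_carrier by (auto simp: F_def)
  with M that show thesis by (auto simp: F_def)
qed

lemma right_ideal_jacobson_radical: "right_ideal (jacobson_radical R) R"
  by (rule right_idealI)
    (auto simp: jacobson_radical_def maximal_right_ideal_def
      intro: right_ideal_zero right_ideal_add right_ideal_mult)

text \<open>If \<open>K\<close> were proper, a maximal right ideal above \<open>K\<close> would also
  contain the Jacobson radical, hence the sum of the two, which is the whole ring.\<close>

lemma delta_small_jacobson_radical: "delta_small (jacobson_radical R) R"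
  unfolding delta_small_def
proof (intro conjI allI impI right_ideal_jacobson_radical)
  fix K
  assume "right_ideal K R \<and> singular_right_module R (quotient_right_module R K) \<and>
    carrier R = jacobson_radical R <+>\<^bsub>R\<^esub> K"
  then have K: "right_ideal K R" and sum: "carrier R = jacobson_radical R <+>\<^bsub>R\<^esub> K" by auto
  show "carrier R = K"
  proof (rule ccontr)
    assume "carrier R \<noteq> K"
    with K obtain M where M: "maximal_right_ideal M R" "K \<subseteq> M"
      using ex_maximal_right_ideal by metis
    then have "right_ideal M R" "M \<noteq> carrier R" by (auto simp: maximal_right_ideal_def)
    moreover have "jacobson_radical R \<subseteq> M" using M by (auto simp: jacobson_radical_def)
    ultimately have "carrier R \<subseteq> M" "M \<subseteq> carrier R" "M \<noteq> carrier R"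
      using set_add_subset_right_ideal[OF _ _ M(2)] sum right_ideal_subset by simp_all
    then show False by blast
  qed
qed

lemma jacobson_radical_subset_delta_radical: "jacobson_radical R \<subseteq> delta_radical R"
  using delta_small_jacobson_radical
  by (auto simp: delta_radical_def right_ideal_sum_def intro: generate.incl)

text \<open>This set is the annihilator of the coset of \<open>x\<close> in R/E, so its essentiality
  makes R/E singular. To meet a given \<open>K\<close>, look at the right ideal xK: if it is zero,
  \<open>K\<close> lies in the set; otherwise it shares a nonzero element
  \<open>x \<otimes> k\<close> with \<open>E\<close>, and \<open>k\<close> is a nonzero common
  element of the set and \<open>K\<close>.\<close>

lemma essential_right_ideal_colon:
  assumes E: "essential_right_ideal E R" and x: "x \<in> carrier R"
  shows "essential_right_ideal {r \<in> carrier R. x \<otimes> r \<in> E} R"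
  unfolding essential_right_ideal_def
proof (intro conjI allI impI)
  let ?C = "{r \<in> carrier R. x \<otimes> r \<in> E}"
  have E': "right_ideal E R" using E by (simp add: essential_right_ideal_def)
  note E_rules = right_ideal_zero[OF E'] right_ideal_add[OF E'] right_ideal_mult[OF E']
  show "right_ideal ?C R"
    using x E_rules by (intro right_idealI) (auto simp: r_distr m_assoc[symmetric])
  fix K assume "right_ideal K R \<and> K \<noteq> {\<zero>}"
  then have K: "right_ideal K R" and nz: "K \<noteq> {\<zero>}" by auto
  note car = right_ideal_subset[OF K, THEN subsetD]
  let ?L = "(\<lambda>k. x \<otimes> k) ` K"
  show "?C \<inter> K \<noteq> {\<zero>}"
  proof (cases "?L = {\<zero>}")
    case True
    then have "x \<otimes> k = \<zero>" if "k \<in> K" for k using that by blast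
    then have "K \<subseteq> ?C" using car E_rules(1) by auto
    with nz show ?thesis by blast
  next
    case False
    have "right_ideal ?L R"
    proof (rule right_idealI)
      show "?L \<subseteq> carrier R" using x car by auto
      show "\<zero> \<in> ?L" using x right_ideal_zero[OF K] by (auto intro!: image_eqI[of _ _ \<zero>])
      show "a \<oplus> b \<in> ?L" if "a \<in> ?L" "b \<in> ?L" for a b
        using that x car right_ideal_add[OF K] by (auto simp: r_distr[symmetric])
      show "a \<otimes> r \<in> ?L" if "a \<in> ?L" "r \<in> carrier R" for a r
        using that x car right_ideal_mult[OF K] by (auto simp: m_assoc)
    qed
    with False E have "E \<inter> ?L \<noteq> {\<zero>}" by (auto simp: essential_right_ideal_def)
    \<comment> \<open>Since zero belongs to the intersection, differing from
      \<open>{\<zero>}\<close> means having a nonzero element.\<close>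
    moreover have "\<zero> \<in> E \<inter> ?L"
      using E_rules(1) right_ideal_zero[OF \<open>right_ideal ?L R\<close>] by blast
    ultimately obtain k where k: "k \<in> K" "x \<otimes> k \<in> E" "x \<otimes> k \<noteq> \<zero>" by blast
    then have "k \<in> ?C \<inter> K" "k \<noteq> \<zero>" using x car by auto
    then show ?thesis by blast
  qed
qed

lemma singular_quotient_essential:
  assumes E: "essential_right_ideal E R"
  shows "singular_right_module R (quotient_right_module R E)"
proof -
  interpret right_ideal E R using E by (simp add: essential_right_ideal_def)
  interpret abelian_subgroup E R by (rule quotient_abelian_subgroup)
  let ?M = "quotient_right_module R E"
  have "C \<in> singular_submodule R ?M" if C: "C \<in> carrier ?M" for C
  proof -
    obtain x where x: "x \<in> carrier R" "C = E +> x"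
      using C by (auto simp: quotient_right_module_def A_RCOSETS_def')
    \<comment> \<open>This turns the vanishing of \<open>r \<odot> C\<close> in the quotient into
      \<open>x \<otimes> r \<in> E\<close>.\<close>
    have coset_eq: "E +> y = E \<longleftrightarrow> y \<in> E" if "y \<in> carrier R" for y
      using that a_rcos_self[of y] a_rcos_const[of y] by auto
    have zero: "\<zero>\<^bsub>?M\<^esub> = E" by (simp add: quotient_right_module_def)
    have smult: "r \<odot>\<^bsub>?M\<^esub> C = E +> x \<otimes> r" if "r \<in> carrier R" for r
      using x that by (simp add: quotient_smult)
    have "right_annihilator R ?M C = {r \<in> carrier R. x \<otimes> r \<in> E}"
      unfolding right_annihilator_def using x(1)
      by (intro Collect_cong conj_cong refl) (simp only: smult zero coset_eq m_closed)
    then show ?thesis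
      using C essential_right_ideal_colon[OF E x(1)] by (simp add: singular_submodule_def)
  qed
  then show ?thesis
    using quotient_right_module by (auto simp: singular_right_module_def singular_submodule_def)
qed

text \<open>A right ideal \<open>L\<close> inside \<open>K\<close> is zero if it lies in
  \<open>M\<close>. Otherwise L + M is the whole ring, and splitting \<open>k \<in> K\<close> as
  \<open>l \<oplus> m\<close> puts \<open>m = k \<oplus> \<ominus> l\<close> into
  \<open>M \<inter> K\<close>; so \<open>m\<close> vanishes and \<open>k = l\<close> lies in
  \<open>L\<close>.\<close>

lemma minimal_right_ideal_complement:
  assumes M: "maximal_right_ideal M R" and K: "right_ideal K R"
    and nz: "K \<noteq> {\<zero>}" and int: "M \<inter> K = {\<zero>}"
  shows "minimal_right_ideal K R"
  unfolding minimal_right_ideal_def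
proof (intro conjI allI impI K nz)
  have M': "right_ideal M R" using M by (simp add: maximal_right_ideal_def)
  fix L assume "right_ideal L R \<and> L \<subseteq> K"
  then have L: "right_ideal L R" and LK: "L \<subseteq> K" by auto
  show "L = {\<zero>} \<or> L = K"
  proof (cases "L \<subseteq> M")
    case True
    with LK int right_ideal_zero[OF L] show ?thesis by blast
  next
    case False
    have "k \<in> L" if k: "k \<in> K" for k
    proof -
      have "k \<in> L <+>\<^bsub>R\<^esub> M"
        using k maximal_right_ideal_set_add[OF M L False] right_ideal_subset[OF K] by auto
      then obtain l m where lm: "l \<in> L" "m \<in> M" "k = l \<oplus> m" by (auto simp: mem_set_add_iff)
      then have car: "l \<in> carrier R" "m \<in> carrier R"
        using right_ideal_subset[OF L] right_ideal_subset[OF M'] by auto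
      have "m = k \<oplus> \<ominus> l" using lm car by algebra
      then have "m \<in> K"
        using k lm(1) LK right_ideal_add[OF K] right_ideal_neg[OF K] by (metis subsetD)
      with int lm have "m = \<zero>" by auto
      with lm car show ?thesis by simp
    qed
    with LK show ?thesis by blast
  qed
qed

lemma delta_small_subset_maximal:
  assumes soc: "right_socle R \<subseteq> jacobson_radical R"
    and I: "delta_small I R" and M: "maximal_right_ideal M R"
  shows "I \<subseteq> M"
proof (rule ccontr)
  assume nsub: "\<not> I \<subseteq> M"
  have M': "right_ideal M R" "M \<noteq> carrier R" using M by (auto simp: maximal_right_ideal_def)
  have I': "right_ideal I R" using I by (simp add: delta_small_def)
  have "I <+>\<^bsub>R\<^esub> M = carrier R" by (rule maximal_right_ideal_set_add[OF M I' nsub])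
  then have "\<not> essential_right_ideal M R"
    using I M' singular_quotient_essential unfolding delta_small_def by metis
  then obtain K where K: "right_ideal K R" "K \<noteq> {\<zero>}" "M \<inter> K = {\<zero>}"
    using M' by (auto simp: essential_right_ideal_def)
  then have "minimal_right_ideal K R" by (rule minimal_right_ideal_complement[OF M])
  then have "K \<subseteq> right_socle R"
    by (auto simp: right_socle_def right_ideal_sum_def intro: generate.incl)
  also have "\<dots> \<subseteq> M" using soc M by (auto simp: jacobson_radical_def)
  \<comment> \<open>\<open>K \<subseteq> M\<close> gives
    \<open>K = M \<inter> K = {\<zero>}\<close>, contrary to the choice of \<open>K\<close>.\<close>
  finally show False using K by blast
qed

text \<open>The left side is the additive subgroup generated by the \<delta>-small right ideals, so
  it suffices that each of them lies in every maximal right ideal.\<close>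

lemma delta_radical_subset_jacobson_radical:
  assumes "right_socle R \<subseteq> jacobson_radical R"
  shows "delta_radical R \<subseteq> jacobson_radical R"
  unfolding delta_radical_def right_ideal_sum_def
proof (rule add.generate_subgroup_incl)
  interpret J: right_ideal "jacobson_radical R" R by (rule right_ideal_jacobson_radical)
  show "subgroup (jacobson_radical R) (add_monoid R)" by (rule J.a_subgroup)
  show "\<Union> {I. delta_small I R} \<subseteq> jacobson_radical R"
  proof (rule Union_least)
    fix I assume "I \<in> {I. delta_small I R}"
    then have I: "delta_small I R" by simp
    then have "I \<subseteq> carrier R" by (simp add: delta_small_def right_ideal_subset)
    then show "I \<subseteq> jacobson_radical R"
      unfolding jacobson_radical_def using delta_small_subset_maximal[OF assms I] by blast
  qed
qed

end

theorem lemma2p5: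
  fixes R (structure)
  assumes "ring R"
  shows "(J_quasipolar R \<longrightarrow> delta_quasipolar R) \<and>
    (right_socle R \<subseteq> jacobson_radical R \<and> delta_quasipolar R \<longrightarrow> J_quasipolar R)"
proof (intro conjI impI)
  note defs = J_quasipolar_def delta_quasipolar_def J_quasipolar_elem_def delta_quasipolar_elem_def
  \<comment> \<open>In both directions the same idempotent \<open>p\<close> serves: the two notions
    differ only in the radical that has to contain \<open>a \<oplus> p\<close>.\<close>
  show "delta_quasipolar R" if "J_quasipolar R"
    using that subsetD[OF ring.jacobson_radical_subset_delta_radical[OF assms]]
    unfolding defs by meson
  show "J_quasipolar R" if "right_socle R \<subseteq> jacobson_radical R \<and> delta_quasipolar R"
    using that subsetD[OF ring.delta_radical_subset_jacobson_radical[OF assms]]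
    unfolding defs by meson
qed

end
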